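(* Let $(\omega_n)_{n\ge 0}$ be a sequence of positive real numbers such that $\sum_n 1/\omega_n<\infty$ and $\lim_{n\to\infty}\omega_n^{1/n}=1$. Let $H$ be a Hilbert holomorphic function space on $\mathbb{D}$ such that $H$ contains the polynomials, the polynomials are dense in $H$, the odd polynomials are not dense in the set of odd functions in $H$ (with respect to the norm of $H$), and $\|z^n\|_H\le 1+\omega_n$ for all $n\ge 0$. Then there exists $f\in H$ such that: (1) the series $\sum_{k=0}^\infty c_k s_k(f)$ converges in $H$ for every sequence $(c_k)_{k\ge 0}$ of complex numbers with $\limsup_{k\to\infty}|c_k|^{1/k}<1$; (2) $f$ lies outside the closed linear span in $H$ of the set of all (sums of) such series.
   Context: $\mathbb{D}$ denotes the open unit disk in $\mathbb{C}$, and $\mathrm{Hol}(\mathbb{D})$ the Fréchet space of holomorphic functions on $\mathbb{D}$ with the topology of uniform convergence on compact sets. A Hilbert holomorphic function space on $\mathbb{D}$ is a (complex) Hilbert space $H$ that is a subset (linear subspace) of $\mathrm{Hol}(\mathbb{D})$ such that the inclusion map $H\hookrightarrow\mathrm{Hol}(\mathbb{D})$ is continuous. A function $f$ on $\mathbb{D}$ is odd if $f(-z)=-f(z)$ for all $z\in\mathbb{D}$. For $f\in\mathrm{Hol}(\mathbb{D})$ with Taylor expansion $f(z)=\sum_{j\ge 0}\widehat{f}(j)z^j$, $s_k(f)(z):=\sum_{j=0}^k\widehat{f}(j)z^j$ denotes the $k$-th Taylor partial sum. $z^n$ denotes the function $z\mapsto z^n$ on $\mathbb{D}$. *)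

theory Defs
  imports "HOL-Complex_Analysis.Complex_Analysis" "HOL-Library.Function_Algebras"
begin

text \<open>
  A function on the open unit disk is encoded as a total function that is 0 off the disk, so that
  equality of functions is equality on the disk and the pointwise operations of
  \<open>Function_Algebras\<close> are the vector space operations.
\<close>

abbreviation disk :: "complex set" where
  "disk \<equiv> ball 0 1"

definition on_disk :: "(complex \<Rightarrow> complex) \<Rightarrow> complex \<Rightarrow> complex" where
  "on_disk f = (\<lambda>z. if z \<in> disk then f z else 0)"

definition Hol_disk :: "(complex \<Rightarrow> complex) set" where
  "Hol_disk = {f. f holomorphic_on disk \<and> (\<forall>z. z \<notin> disk \<longrightarrow> f z = 0)}"

definition cscale :: "complex \<Rightarrow> (complex \<Rightarrow> complex) \<Rightarrow> complex \<Rightarrow> complex" where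
  "cscale c f = (\<lambda>z. c * f z)"

lemma cscale_apply [simp]: "cscale c f z = c * f z"
  by (simp add: cscale_def)

global_interpretation cfun: vector_space cscale
  by standard (simp_all add: fun_eq_iff algebra_simps)

text \<open>The topology of uniform convergence on compact subsets of the disk.\<close>

definition Hol_nbhd :: "(complex \<Rightarrow> complex) \<Rightarrow> complex set \<Rightarrow> real \<Rightarrow> (complex \<Rightarrow> complex) set" where
  "Hol_nbhd f K e = {g \<in> Hol_disk. \<forall>z\<in>K. norm (g z - f z) < e}"

definition Hol_open :: "(complex \<Rightarrow> complex) set \<Rightarrow> bool" where
  "Hol_open U \<longleftrightarrow> U \<subseteq> Hol_disk \<and>
     (\<forall>f\<in>U. \<exists>K e. compact K \<and> K \<subseteq> disk \<and> e > 0 \<and> Hol_nbhd f K e \<subseteq> U)"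

definition Hol_topology :: "(complex \<Rightarrow> complex) topology" where
  "Hol_topology = topology Hol_open"

lemma istopology_Hol_open: "istopology Hol_open"
  unfolding istopology_def
proof (intro conjI allI impI)
  fix S T assume S: "Hol_open S" and T: "Hol_open T"
  show "Hol_open (S \<inter> T)"
    unfolding Hol_open_def
  proof (intro conjI ballI)
    show "S \<inter> T \<subseteq> Hol_disk" using S by (auto simp: Hol_open_def)
    fix f assume f: "f \<in> S \<inter> T"
    obtain K d where K: "compact K" "K \<subseteq> disk" "d > 0" "Hol_nbhd f K d \<subseteq> S"
      using S f unfolding Hol_open_def by blast
    obtain L e where L: "compact L" "L \<subseteq> disk" "e > 0" "Hol_nbhd f L e \<subseteq> T"
      using T f unfolding Hol_open_def by blast
    have "Hol_nbhd f (K \<union> L) (min d e) \<subseteq> S \<inter> T"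
      using K(4) L(4) by (fastforce simp: Hol_nbhd_def)
    moreover have "compact (K \<union> L)" "K \<union> L \<subseteq> disk" "min d e > 0"
      using K L by (auto intro: compact_Un)
    ultimately show "\<exists>K e. compact K \<and> K \<subseteq> disk \<and> e > 0 \<and> Hol_nbhd f K e \<subseteq> S \<inter> T"
      by blast
  qed
next
  fix \<K> assume K: "\<forall>U\<in>\<K>. Hol_open U"
  show "Hol_open (\<Union>\<K>)"
    unfolding Hol_open_def
  proof (intro conjI ballI)
    show "\<Union>\<K> \<subseteq> Hol_disk" using K by (auto simp: Hol_open_def)
    fix f assume "f \<in> \<Union>\<K>"
    then obtain U where "U \<in> \<K>" "f \<in> U" by blast
    then show "\<exists>K e. compact K \<and> K \<subseteq> disk \<and> e > 0 \<and> Hol_nbhd f K e \<subseteq> \<Union>\<K>"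
      using K unfolding Hol_open_def by (meson Union_upper order_trans)
  qed
qed

lemma openin_Hol_topology: "openin Hol_topology U \<longleftrightarrow> Hol_open U"
  by (simp add: Hol_topology_def topology_inverse'[OF istopology_Hol_open])

lemma topspace_Hol_topology: "topspace Hol_topology = Hol_disk"
proof
  show "topspace Hol_topology \<subseteq> Hol_disk"
    by (auto simp: topspace_def openin_Hol_topology Hol_open_def)
  have "Hol_open Hol_disk"
    unfolding Hol_open_def Hol_nbhd_def
    by (intro conjI ballI exI[of _ "{}"] exI[of _ "1::real"]) auto
  then show "Hol_disk \<subseteq> topspace Hol_topology"
    by (auto simp: topspace_def openin_Hol_topology)
qed

text \<open>
  Complex inner product spaces of functions: a space is given by its carrier \<open>H\<close> and its inner
  product \<open>ip\<close>, which is linear in the first argument. The values of \<open>ip\<close> outside \<open>H\<close> are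
  arbitrary, while \<open>Metric_space\<close> requires nonnegativity and symmetry everywhere; hence the case
  distinction in the metric.
\<close>

definition ip_norm :: "('a \<Rightarrow> 'a \<Rightarrow> complex) \<Rightarrow> 'a \<Rightarrow> real" where
  "ip_norm ip f = sqrt (Re (ip f f))"

definition ip_dist :: "'a::minus set \<Rightarrow> ('a \<Rightarrow> 'a \<Rightarrow> complex) \<Rightarrow> 'a \<Rightarrow> 'a \<Rightarrow> real" where
  "ip_dist H ip f g = (if f \<in> H \<and> g \<in> H then ip_norm ip (f - g) else 0)"

definition ip_topology :: "'a::minus set \<Rightarrow> ('a \<Rightarrow> 'a \<Rightarrow> complex) \<Rightarrow> 'a topology" where
  "ip_topology H ip = Metric_space.mtopology H (ip_dist H ip)"

definition ip_sums ::
  "'a::ab_group_add set \<Rightarrow> ('a \<Rightarrow> 'a \<Rightarrow> complex) \<Rightarrow> (nat \<Rightarrow> 'a) \<Rightarrow> 'a \<Rightarrow> bool" where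
  "ip_sums H ip u s \<longleftrightarrow> limitin (ip_topology H ip) (\<lambda>n. \<Sum>k<n. u k) s sequentially"

locale function_inner_product_space =
  fixes H :: "(complex \<Rightarrow> complex) set"
    and ip :: "(complex \<Rightarrow> complex) \<Rightarrow> (complex \<Rightarrow> complex) \<Rightarrow> complex"
  assumes subspace: "cfun.subspace H"
    and ip_add_left: "\<lbrakk>f \<in> H; g \<in> H; h \<in> H\<rbrakk> \<Longrightarrow> ip (f + g) h = ip f h + ip g h"
    and ip_scale_left: "\<lbrakk>f \<in> H; g \<in> H\<rbrakk> \<Longrightarrow> ip (cscale c f) g = c * ip f g"
    and ip_commute: "\<lbrakk>f \<in> H; g \<in> H\<rbrakk> \<Longrightarrow> ip g f = cnj (ip f g)"
    and ip_nonneg: "f \<in> H \<Longrightarrow> 0 \<le> Re (ip f f)"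
    and ip_definite: "\<lbrakk>f \<in> H; ip f f = 0\<rbrakk> \<Longrightarrow> f = 0"
begin

lemma ip_add_right:
  assumes "f \<in> H" "g \<in> H" "h \<in> H"
  shows "ip h (f + g) = ip h f + ip h g"
  using assms ip_commute[of "f + g" h] ip_commute[of f h] ip_commute[of g h]
  by (simp add: ip_add_left cfun.subspace_add[OF subspace])

lemma ip_scale_right:
  assumes "f \<in> H" "g \<in> H"
  shows "ip g (cscale c f) = cnj c * ip g f"
  using assms ip_commute[of "cscale c f" g] ip_commute[of f g]
  by (simp add: ip_scale_left cfun.subspace_scale[OF subspace])

lemma Im_ip_self: "f \<in> H \<Longrightarrow> Im (ip f f) = 0"
  using ip_commute[of f f] by (simp add: complex_eq_iff)

lemma ip_norm_nonneg: "f \<in> H \<Longrightarrow> 0 \<le> ip_norm ip f"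
  by (simp add: ip_norm_def ip_nonneg)

lemma ip_norm_eq_0_iff: "f \<in> H \<Longrightarrow> ip_norm ip f = 0 \<longleftrightarrow> f = 0"
proof
  assume f: "f \<in> H" and "ip_norm ip f = 0"
  then have "ip f f = 0"
    by (simp add: ip_norm_def Im_ip_self complex_eq_iff)
  with f show "f = 0" by (rule ip_definite)
next
  assume f: "f \<in> H" "f = 0"
  then have "ip (cscale 0 f) f = 0" by (subst ip_scale_left) auto
  moreover have "cscale 0 f = f" using f by (simp add: fun_eq_iff)
  ultimately show "ip_norm ip f = 0" by (simp add: ip_norm_def)
qed

lemma ip_norm_scale: "f \<in> H \<Longrightarrow> ip_norm ip (cscale c f) = cmod c * ip_norm ip f"
proof -
  assume f: "f \<in> H"
  have "ip (cscale c f) (cscale c f) = (c * cnj c) * ip f f"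
    using f by (simp add: ip_scale_left ip_scale_right cfun.subspace_scale[OF subspace])
  then have "Re (ip (cscale c f) (cscale c f)) = (cmod c)\<^sup>2 * Re (ip f f)"
    by (simp flip: complex_norm_square)
  then show ?thesis by (simp add: ip_norm_def real_sqrt_mult)
qed

lemma Re_ip_le:
  assumes f: "f \<in> H" and g: "g \<in> H"
  shows "Re (ip f g) \<le> ip_norm ip f * ip_norm ip g"
proof -
  have *: "0 \<le> a\<^sup>2 * Re (ip f f) + 2 * a * b * Re (ip f g) + b\<^sup>2 * Re (ip g g)" for a b :: real
  proof -
    let ?u = "cscale (of_real a) f" and ?v = "cscale (of_real b) g"
    have uv: "?u \<in> H" "?v \<in> H" using f g by (auto intro: cfun.subspace_scale[OF subspace])
    have "0 \<le> Re (ip (?u + ?v) (?u + ?v))"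
      using uv by (intro ip_nonneg cfun.subspace_add[OF subspace])
    also have "ip (?u + ?v) (?u + ?v) =
        a * a * ip f f + a * b * (ip f g + ip g f) + b * b * ip g g"
      using f g uv
      by (simp add: ip_add_left ip_add_right ip_scale_left ip_scale_right
          cfun.subspace_add[OF subspace] algebra_simps)
    finally show ?thesis
      using ip_commute[OF f g] by (simp add: algebra_simps power2_eq_square)
  qed
  let ?p = "ip_norm ip f" and ?q = "ip_norm ip g"
  have p: "Re (ip f f) = ?p\<^sup>2" and q: "Re (ip g g) = ?q\<^sup>2"
    using f g by (simp_all add: ip_norm_def ip_nonneg)
  show ?thesis
  proof (cases "?p = 0 \<or> ?q = 0")
    case True
    then have "f = 0 \<or> g = 0" using f g by (simp add: ip_norm_eq_0_iff)
    then have "ip f g = 0"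
    proof
      assume "f = 0"
      then show ?thesis using ip_scale_left[OF f g, of 0] by simp
    next
      assume "g = 0"
      then show ?thesis using ip_scale_right[OF g f, of 0] by simp
    qed
    then show ?thesis using True by auto
  next
    case False
    then have pos: "?p > 0" "?q > 0" using ip_norm_nonneg f g by (auto simp: less_le)
    have "0 \<le> 2 * (?p * ?q) * (?p * ?q - Re (ip f g))"
      using *[of ?q "- ?p"] by (simp add: p q algebra_simps power2_eq_square)
    moreover have "0 < 2 * (?p * ?q)" using pos by simp
    ultimately have "0 \<le> ?p * ?q - Re (ip f g)" by (simp only: zero_le_mult_iff) linarith
    then show ?thesis by simp
  qed
qed

lemma ip_norm_triangle:
  assumes f: "f \<in> H" and g: "g \<in> H"
  shows "ip_norm ip (f + g) \<le> ip_norm ip f + ip_norm ip g"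
proof (rule power2_le_imp_le)
  have fg: "f + g \<in> H" using f g by (rule cfun.subspace_add[OF subspace])
  have "(ip_norm ip (f + g))\<^sup>2 = Re (ip f f) + 2 * Re (ip f g) + Re (ip g g)"
    using f g fg ip_commute[OF f g]
    by (simp add: ip_norm_def ip_nonneg) (simp add: ip_add_left ip_add_right fg)
  also have "\<dots> = (ip_norm ip f)\<^sup>2 + 2 * Re (ip f g) + (ip_norm ip g)\<^sup>2"
    using f g by (simp add: ip_norm_def ip_nonneg)
  also have "\<dots> \<le> (ip_norm ip f + ip_norm ip g)\<^sup>2"
    using Re_ip_le[OF f g] by (simp add: power2_sum)
  finally show "(ip_norm ip (f + g))\<^sup>2 \<le> (ip_norm ip f + ip_norm ip g)\<^sup>2" .
  show "0 \<le> ip_norm ip f + ip_norm ip g" using f g by (simp add: ip_norm_nonneg)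
qed

sublocale Metric_space H "ip_dist H ip"
proof
  have diff: "f - g \<in> H" if "f \<in> H" "g \<in> H" for f g
    using that by (rule cfun.subspace_diff[OF subspace])
  fix f g h
  show "0 \<le> ip_dist H ip f g"
    by (simp add: ip_dist_def ip_norm_nonneg diff)
  show "ip_dist H ip f g = ip_dist H ip g f"
  proof (cases "f \<in> H \<and> g \<in> H")
    case True
    have "f - g = cscale (-1) (g - f)" by (simp add: fun_eq_iff)
    then have "ip_norm ip (f - g) = cmod (-1) * ip_norm ip (g - f)"
      using True diff by (simp only: ip_norm_scale)
    with True show ?thesis by (simp add: ip_dist_def)
  qed (auto simp: ip_dist_def)
  show "ip_dist H ip f g = 0 \<longleftrightarrow> f = g" if "f \<in> H" "g \<in> H"
    using that by (simp add: ip_dist_def ip_norm_eq_0_iff diff)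
  show "ip_dist H ip f h \<le> ip_dist H ip f g + ip_dist H ip g h"
    if "f \<in> H" "g \<in> H" "h \<in> H"
    using that ip_norm_triangle[of "f - g" "g - h"] by (simp add: ip_dist_def diff)
qed

end

locale hilbert_holomorphic_space = function_inner_product_space +
  assumes subset_Hol: "H \<subseteq> Hol_disk"
    and complete: "Metric_space.mcomplete H (ip_dist H ip)"
    and inclusion_continuous: "continuous_map (ip_topology H ip) Hol_topology id"

definition disk_polys :: "(complex \<Rightarrow> complex) set" where
  "disk_polys = {on_disk (poly p) | p. True}"

definition odd_on_disk :: "(complex \<Rightarrow> complex) \<Rightarrow> bool" where
  "odd_on_disk f \<longleftrightarrow> (\<forall>z\<in>disk. f (- z) = - f z)"

definition taylor_psum :: "nat \<Rightarrow> (complex \<Rightarrow> complex) \<Rightarrow> complex \<Rightarrow> complex" where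
  "taylor_psum k f = on_disk (\<lambda>z. \<Sum>j\<le>k. fps_nth (fps_expansion f 0) j * z ^ j)"

definition admissible_coeffs :: "(nat \<Rightarrow> complex) \<Rightarrow> bool" where
  "admissible_coeffs c \<longleftrightarrow> limsup (\<lambda>k. ereal (root k (cmod (c k)))) < 1"

definition taylor_series_sums ::
  "(complex \<Rightarrow> complex) set \<Rightarrow> ((complex \<Rightarrow> complex) \<Rightarrow> (complex \<Rightarrow> complex) \<Rightarrow> complex) \<Rightarrow>
   (complex \<Rightarrow> complex) \<Rightarrow> (complex \<Rightarrow> complex) set" where
  "taylor_series_sums H ip f =
     {s. \<exists>c. admissible_coeffs c \<and> ip_sums H ip (\<lambda>k. cscale (c k) (taylor_psum k f)) s}"

end

theory Submission
  imports Defs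
begin

text \<open>
  The Taylor partial sums of an odd function are odd polynomials. Hence every odd \<open>f\<close> in \<open>H\<close> outside
  the closure of the odd polynomials satisfies (2). Condition (1) holds for every \<open>f\<close> in \<open>H\<close>: the
  norms of its Taylor partial sums grow subexponentially, so the series converges absolutely.
\<close>

section \<open>Oddness of the Taylor partial sums\<close>

text \<open>The chain rule gives \<open>f (- w)\<close> the same even-order derivatives at 0 as
  \<open>f\<close>, since \<open>(- 1) ^ n = 1\<close>. Oddness gives them the opposite sign, so
  they equal their own negatives.\<close>

lemma higher_deriv_odd_eq_0:
  fixes f :: "complex \<Rightarrow> complex"
  assumes f: "f holomorphic_on S" and S: "open S" "0 \<in> S" "\<And>z. z \<in> S \<Longrightarrow> - z \<in> S"
    and odd: "\<And>z. z \<in> S \<Longrightarrow> f (- z) = - f z" and n: "even n"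
  shows "(deriv ^^ n) f 0 = 0"
proof -
  have "(deriv ^^ n) (\<lambda>w. f (- 1 * w)) 0 = (- 1) ^ n * (deriv ^^ n) f (- 1 * 0)"
    using f S by (intro higher_deriv_compose_linear[of f S S]) auto
  also have "\<dots> = (deriv ^^ n) f 0"
    using n by simp
  finally have "(deriv ^^ n) f 0 = (deriv ^^ n) (\<lambda>w. f (- 1 * w)) 0" ..
  \<comment> \<open>Oddness is known only on \<open>S\<close>, so the derivatives are compared
    through agreement on an open set containing 0.\<close>
  also have "\<dots> = (deriv ^^ n) (\<lambda>w. - f w) 0"
  proof (rule higher_deriv_transform_within_open[of _ S])
    show "(\<lambda>w. f (- 1 * w)) holomorphic_on S"
      by (rule holomorphic_on_compose_gen[of "\<lambda>w. - 1 * w" S f S, unfolded o_def])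
        (use f S in \<open>auto intro!: holomorphic_intros\<close>)
  qed (use f S odd in \<open>auto intro!: holomorphic_intros\<close>)
  also have "\<dots> = - (deriv ^^ n) f 0"
    using f S by (intro higher_deriv_uminus)
  finally show ?thesis by simp
qed

lemma sum_fun_apply: "(\<Sum>i\<in>A. f i) x = (\<Sum>i\<in>A. f i x)"
  by (induction A rule: infinite_finite_induct) simp_all

lemma taylor_psum_eq_sum:
  "taylor_psum k f = (\<Sum>j\<le>k. cscale (fps_nth (fps_expansion f 0) j) (on_disk (\<lambda>z. z ^ j)))"
  by (simp add: fun_eq_iff taylor_psum_def on_disk_def sum_fun_apply)

lemma taylor_psum_in_disk_polys: "taylor_psum k f \<in> disk_polys"
proof -
  have "taylor_psum k f = on_disk (poly (\<Sum>j\<le>k. monom (fps_nth (fps_expansion f 0) j) j))"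
    by (simp add: fun_eq_iff taylor_psum_def on_disk_def poly_sum poly_monom)
  then show ?thesis
    unfolding disk_polys_def by blast
qed

text \<open>The coefficients of even index vanish, and each remaining power of \<open>z\<close> is
  itself odd.\<close>

lemma odd_taylor_psum:
  assumes f: "f holomorphic_on disk" and odd: "odd_on_disk f"
  shows "odd_on_disk (taylor_psum k f)"
proof -
  let ?a = "fps_nth (fps_expansion f 0)"
  have "?a j = 0" if "even j" for j
    using higher_deriv_odd_eq_0[OF f, of j] odd that by (simp add: odd_on_disk_def fps_expansion_def)
  then have "?a j * (- z) ^ j = - (?a j * z ^ j)" for j z
    by (cases "even j") auto
  then show ?thesis
    by (simp add: odd_on_disk_def taylor_psum_def on_disk_def sum_negf)
qed

text \<open>Keeps the finite sums of scaled Taylor partial sums among the odd polynomials, and lets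
  their closure absorb linear spans.\<close>

lemma subspace_odd_disk_polys: "cfun.subspace {p \<in> disk_polys. odd_on_disk p}"
proof (rule cfun.subspaceI)
  show "0 \<in> {p \<in> disk_polys. odd_on_disk p}"
    by (auto simp: disk_polys_def odd_on_disk_def on_disk_def fun_eq_iff intro!: exI[of _ 0])
next
  fix f g assume "f \<in> {p \<in> disk_polys. odd_on_disk p}" "g \<in> {p \<in> disk_polys. odd_on_disk p}"
  moreover have "on_disk (poly p) + on_disk (poly q) = on_disk (poly (p + q))" for p q
    by (simp add: fun_eq_iff on_disk_def)
  ultimately show "f + g \<in> {p \<in> disk_polys. odd_on_disk p}"
    by (auto simp: disk_polys_def odd_on_disk_def)
next
  fix c f assume "f \<in> {p \<in> disk_polys. odd_on_disk p}"
  moreover have "cscale c (on_disk (poly p)) = on_disk (poly (smult c p))" for p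
    by (simp add: fun_eq_iff on_disk_def)
  ultimately show "cscale c f \<in> {p \<in> disk_polys. odd_on_disk p}"
    by (auto simp: disk_polys_def odd_on_disk_def)
qed

section \<open>Radii of convergence and subexponential growth\<close>

text \<open>\<open>conv_radius\<close> is the inverse of the limsup of the roots. Inversion reverses
  the comparison with 1 because that limsup is nonnegative; a limsup of 0 corresponds to infinite
  radius.\<close>

lemma admissible_coeffs_iff: "admissible_coeffs c \<longleftrightarrow> 1 < conv_radius c"
proof -
  define l where "l = limsup (\<lambda>k. ereal (root k (cmod (c k))))"
  have "0 = limsup (\<lambda>k::nat. 0 :: ereal)"
    by (simp add: Limsup_const)
  also have "\<dots> \<le> l"
    unfolding l_def by (intro Limsup_mono) (simp_all add: real_root_ge_zero)
  finally have "l < 1 \<longleftrightarrow> 1 < inverse l"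
    by (cases l) (auto simp: one_ereal_def one_less_inverse_iff)
  then show ?thesis
    by (simp add: admissible_coeffs_def conv_radius_def l_def)
qed

text \<open>Split \<open>t ^ j\<close> into two copies of \<open>sqrt t ^ j\<close>, where
  \<open>sqrt t < 1\<close> lies inside both radii. One copy makes the \<open>a\<close> factor
  bounded, the other makes the \<open>w\<close> factor summable. Intended for Taylor coefficients
  \<open>a\<close> and bounds \<open>w\<close> on the norms of the monomials.\<close>

lemma summable_mult_subexponential:
  fixes a :: "nat \<Rightarrow> 'a :: {banach, real_normed_div_algebra}" and w :: "nat \<Rightarrow> real"
  assumes a: "1 \<le> conv_radius a" and w: "1 \<le> conv_radius w" and t: "0 \<le> t" "t < 1"
  shows "summable (\<lambda>j. norm (a j) * norm (w j) * t ^ j)"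
proof -
  have sqrt: "ereal (sqrt t) < 1" using t by (simp add: one_ereal_def)
  have sw: "summable (\<lambda>j. norm (w j * sqrt t ^ j))"
    using t less_le_trans[OF sqrt w] by (intro abs_summable_in_conv_radius) simp
  have "summable (\<lambda>j. norm (a j * of_real (sqrt t) ^ j))"
    using t less_le_trans[OF sqrt a] by (intro abs_summable_in_conv_radius) simp
  then have "Bseq (\<lambda>j. norm (a j * of_real (sqrt t) ^ j))"
    by (rule convergent_imp_Bseq[OF convergentI[OF summable_LIMSEQ_zero]])
  then obtain B where B: "\<And>j. norm (a j * of_real (sqrt t) ^ j) \<le> B"
    unfolding Bseq_def by (metis real_norm_def abs_le_D1)
  show ?thesis
  proof (rule summable_comparison_test')
    show "summable (\<lambda>j. B * norm (w j * sqrt t ^ j))"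
      using sw by (rule summable_mult)
    fix j :: nat assume "0 \<le> j"
    have "t ^ j = sqrt t ^ j * sqrt t ^ j"
      using t by (simp flip: power_mult_distrib)
    then have "norm (norm (a j) * norm (w j) * t ^ j)
        = norm (a j * of_real (sqrt t) ^ j) * norm (w j * sqrt t ^ j)"
      using t by (simp add: norm_mult norm_power abs_mult power_abs)
    also have "\<dots> \<le> B * norm (w j * sqrt t ^ j)"
      using B by (rule mult_right_mono) simp
    finally show "norm (norm (a j) * norm (w j) * t ^ j) \<le> B * norm (w j * sqrt t ^ j)" .
  qed
qed

text \<open>For each \<open>R > 1\<close> the partial sums of \<open>b\<close> are at most a
  constant times \<open>R ^ k\<close>, and the decay of \<open>c\<close> beats such growth once
  \<open>R\<close> is close enough to 1.\<close>

lemma summable_mult_partial_sums: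
  fixes c :: "nat \<Rightarrow> 'a :: {banach, real_normed_div_algebra}" and b :: "nat \<Rightarrow> real"
  assumes c: "1 < conv_radius c" and nonneg: "\<And>j. 0 \<le> b j"
    and b: "\<And>t. \<lbrakk>0 \<le> t; t < 1\<rbrakk> \<Longrightarrow> summable (\<lambda>j. b j * t ^ j)"
  shows "summable (\<lambda>k. norm (c k) * (\<Sum>j\<le>k. b j))"
proof -
  \<comment> \<open>\<open>R > 1\<close> makes \<open>1 / R\<close> an admissible \<open>t\<close>
    for \<open>b\<close>; \<open>R\<close> below the radius of \<open>c\<close> keeps the terms
    \<open>c k * of_real R ^ k\<close> absolutely summable.\<close>
  obtain R :: real where R: "1 < R" "ereal R < conv_radius c"
    using ereal_dense2[OF c] by (auto simp: one_ereal_def)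
  then have c_sum: "summable (\<lambda>k. norm (c k * of_real R ^ k))"
    by (intro abs_summable_in_conv_radius) simp
  have b_sum: "summable (\<lambda>j. b j * (1 / R) ^ j)"
    using R by (intro b) auto
  define B where "B = (\<Sum>j. b j * (1 / R) ^ j)"
  have B: "(\<Sum>j\<le>k. b j) \<le> B * R ^ k" for k
  proof -
    \<comment> \<open>Each nonnegative term is enlarged by the factor \<open>R ^ (k - j)\<close>,
      which is at least 1 as \<open>j \<le> k\<close>.\<close>
    have "(\<Sum>j\<le>k. b j) \<le> (\<Sum>j\<le>k. b j * (1 / R) ^ j * R ^ k)"
    proof (rule sum_mono)
      fix j assume "j \<in> {..k}"
      then have "R ^ j \<le> R ^ k" using R by (intro power_increasing) auto
      then have "1 \<le> (1 / R) ^ j * R ^ k"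
        using R by (simp add: power_divide)
      then show "b j \<le> b j * (1 / R) ^ j * R ^ k"
        using mult_left_mono[OF _ nonneg[of j]] by (fastforce simp: mult.assoc)
    qed
    also have "\<dots> = (\<Sum>j\<le>k. b j * (1 / R) ^ j) * R ^ k"
      by (simp add: sum_distrib_right)
    also have "\<dots> \<le> B * R ^ k"
      unfolding B_def using R nonneg b_sum by (intro mult_right_mono sum_le_suminf) auto
    finally show ?thesis .
  qed
  show ?thesis
  proof (rule summable_comparison_test')
    show "summable (\<lambda>k. B * norm (c k * of_real R ^ k))"
      using c_sum by (rule summable_mult)
    fix k :: nat assume "0 \<le> k"
    have "norm (norm (c k) * (\<Sum>j\<le>k. b j)) = norm (c k) * (\<Sum>j\<le>k. b j)"
      by (simp add: abs_mult nonneg sum_nonneg)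
    also have "\<dots> \<le> norm (c k) * (B * R ^ k)"
      using B by (rule mult_left_mono) simp
    also have "\<dots> = B * norm (c k * of_real R ^ k)"
      using R by (simp add: norm_mult norm_power)
    finally show "norm (norm (c k) * (\<Sum>j\<le>k. b j)) \<le> B * norm (c k * of_real R ^ k)" .
  qed
qed

section \<open>Convergent series and closed subspaces in the inner product space\<close>

context function_inner_product_space
begin

lemma ip_norm_sum_le:
  assumes "finite A" "\<And>i. i \<in> A \<Longrightarrow> u i \<in> H"
  shows "ip_norm ip (\<Sum>i\<in>A. u i) \<le> (\<Sum>i\<in>A. ip_norm ip (u i))"
  using assms
proof (induction A)
  case empty
  then show ?case
    using ip_norm_eq_0_iff[of 0] cfun.subspace_0[OF subspace] by (simp add: zero_fun_def)
next
  case (insert i A)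
  then have "ip_norm ip (u i + (\<Sum>i\<in>A. u i)) \<le> ip_norm ip (u i) + ip_norm ip (\<Sum>i\<in>A. u i)"
    by (intro ip_norm_triangle cfun.subspace_sum[OF subspace]) auto
  moreover have "ip_norm ip (\<Sum>i\<in>A. u i) \<le> (\<Sum>i\<in>A. ip_norm ip (u i))"
    using insert by simp
  ultimately show ?case
    unfolding sum.insert[OF insert(1,2)] by linarith
qed

text \<open>Absolute convergence in a complete space: the distance between two partial sums is at
  most a block of the series of norms, so the partial sums are Cauchy.\<close>

lemma ip_sums_of_summable_norm:
  assumes complete: "mcomplete" and u: "\<And>k. u k \<in> H"
    and summable: "summable (\<lambda>k. ip_norm ip (u k))"
  shows "\<exists>s. ip_sums H ip u s"
proof -
  let ?S = "\<lambda>n. \<Sum>k<n. u k"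
  have in_H: "sum u A \<in> H" for A
    using u by (intro cfun.subspace_sum[OF subspace])
  have "MCauchy ?S"
    unfolding MCauchy_def
  proof (intro conjI allI impI)
    show "range ?S \<subseteq> H" using in_H by auto
    fix e :: real assume "e > 0"
    then obtain N where N: "\<And>m n. m \<ge> N \<Longrightarrow> norm (\<Sum>k=m..<n. ip_norm ip (u k)) < e"
      using summable unfolding summable_Cauchy by blast
    \<comment> \<open>With the indices ordered, the difference is a sum over \<open>{m..<n}\<close>;
      the other order follows by symmetry of the metric.\<close>
    have less: "ip_dist H ip (?S n) (?S m) < e" if "N \<le> m" "m \<le> n" for m n
    proof -
      have "?S n - ?S m = (\<Sum>k=m..<n. u k)"
        using \<open>m \<le> n\<close> sum_diff_nat_ivl[of 0 m n u] by (simp add: atLeast0LessThan)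
      then have "ip_dist H ip (?S n) (?S m) \<le> (\<Sum>k=m..<n. ip_norm ip (u k))"
        using ip_norm_sum_le[of "{m..<n}" u] u in_H by (simp add: ip_dist_def)
      also have "\<dots> < e" using N[OF \<open>N \<le> m\<close>, of n] by (simp add: abs_less_iff)
      finally show ?thesis .
    qed
    show "\<exists>N. \<forall>n n'. N \<le> n \<longrightarrow> N \<le> n' \<longrightarrow> ip_dist H ip (?S n) (?S n') < e"
    proof (intro exI[of _ N] allI impI)
      fix n n' assume "N \<le> n" "N \<le> n'"
      then show "ip_dist H ip (?S n) (?S n') < e"
        using less[of n n'] less[of n' n] by (cases "n \<le> n'") (auto simp: commute)
    qed
  qed
  then show ?thesis
    using complete unfolding mcomplete_def ip_sums_def ip_topology_def by blast
qed

lemma in_closure_of_iff: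
  assumes "V \<subseteq> H"
  shows "f \<in> ip_topology H ip closure_of V \<longleftrightarrow> f \<in> H \<and> (\<forall>r>0. \<exists>g\<in>V. ip_norm ip (f - g) < r)"
proof -
  have "g \<in> mball f r \<longleftrightarrow> f \<in> H \<and> ip_norm ip (f - g) < r" if "g \<in> V" for g r
    using assms that by (auto simp: ip_dist_def)
  then show ?thesis
    unfolding ip_topology_def metric_closure_of by blast
qed

text \<open>Approximants in \<open>V\<close> can be added and scaled: errors below
  \<open>r / 2\<close> handle sums, and an error below \<open>r / (1 + cmod c)\<close> handles
  multiples.\<close>

lemma subspace_closure_of:
  assumes V: "cfun.subspace V" "V \<subseteq> H"
  shows "cfun.subspace (ip_topology H ip closure_of V)"
proof (rule cfun.subspaceI)
  have "V \<subseteq> ip_topology H ip closure_of V"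
    using V(2) by (intro closure_of_subset) (simp add: ip_topology_def)
  then show "0 \<in> ip_topology H ip closure_of V"
    using cfun.subspace_0[OF V(1)] by auto
next
  fix f g assume "f \<in> ip_topology H ip closure_of V" "g \<in> ip_topology H ip closure_of V"
  then have H: "f \<in> H" "g \<in> H"
    and f: "\<And>r. r > 0 \<Longrightarrow> \<exists>h\<in>V. ip_norm ip (f - h) < r"
    and g: "\<And>r. r > 0 \<Longrightarrow> \<exists>h\<in>V. ip_norm ip (g - h) < r"
    by (auto simp: in_closure_of_iff[OF V(2)])
  show "f + g \<in> ip_topology H ip closure_of V"
    unfolding in_closure_of_iff[OF V(2)]
  proof (intro conjI allI impI)
    show "f + g \<in> H" using H by (rule cfun.subspace_add[OF subspace])
    fix r :: real assume "r > 0"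
    then obtain h k where hk: "h \<in> V" "k \<in> V" "ip_norm ip (f - h) < r / 2" "ip_norm ip (g - k) < r / 2"
      using f[of "r / 2"] g[of "r / 2"] by auto
    have "ip_norm ip ((f - h) + (g - k)) \<le> ip_norm ip (f - h) + ip_norm ip (g - k)"
      using H hk V(2) by (intro ip_norm_triangle cfun.subspace_diff[OF subspace]) auto
    then have "ip_norm ip (f + g - (h + k)) < r"
      using hk by (simp add: algebra_simps)
    then show "\<exists>h\<in>V. ip_norm ip (f + g - h) < r"
      using hk cfun.subspace_add[OF V(1)] by blast
  qed
next
  fix c f assume "f \<in> ip_topology H ip closure_of V"
  then have H: "f \<in> H" and f: "\<And>r. r > 0 \<Longrightarrow> \<exists>h\<in>V. ip_norm ip (f - h) < r"
    by (auto simp: in_closure_of_iff[OF V(2)])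
  show "cscale c f \<in> ip_topology H ip closure_of V"
    unfolding in_closure_of_iff[OF V(2)]
  proof (intro conjI allI impI)
    show "cscale c f \<in> H" using H by (rule cfun.subspace_scale[OF subspace])
    fix r :: real assume "r > 0"
    \<comment> \<open>The added 1 keeps the denominator positive when \<open>c = 0\<close>.\<close>
    then obtain h where h: "h \<in> V" "ip_norm ip (f - h) < r / (1 + cmod c)"
      using f[of "r / (1 + cmod c)"] by (auto simp: add_pos_nonneg)
    have fh: "f - h \<in> H" using H h V(2) by (intro cfun.subspace_diff[OF subspace]) auto
    have "cmod c * ip_norm ip (f - h) \<le> (1 + cmod c) * ip_norm ip (f - h)"
      using ip_norm_nonneg[OF fh] by (intro mult_right_mono) auto
    also have "\<dots> < r"
      using h(2) by (simp add: pos_less_divide_eq add_pos_nonneg mult.commute)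
    finally have "ip_norm ip (cscale c (f - h)) < r"
      using fh by (simp add: ip_norm_scale)
    moreover have "cscale c (f - h) = cscale c f - cscale c h"
      by (rule cfun.scale_right_diff_distrib)
    ultimately show "\<exists>k\<in>V. ip_norm ip (cscale c f - k) < r"
      using h(1) cfun.subspace_scale[OF V(1)] by metis
  qed
qed

lemma ip_sums_in_closure_of:
  assumes "cfun.subspace V" "\<And>k. u k \<in> V" "ip_sums H ip u s"
  shows "s \<in> ip_topology H ip closure_of V"
proof (rule limitin_closedin)
  show "limitin (ip_topology H ip) (\<lambda>n. \<Sum>k<n. u k) s sequentially"
    using assms(3) by (simp add: ip_sums_def)
  \<comment> \<open>Points of the closure must lie in the whole space; convergence supplies this for
    all late partial sums by taking the whole space as a neighbourhood of \<open>s\<close>.\<close>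
  then have "\<forall>\<^sub>F n in sequentially. (\<Sum>k<n. u k) \<in> topspace (ip_topology H ip)"
    by (auto simp: limitin_def)
  moreover have "(\<Sum>k<n. u k) \<in> V" for n
    using assms by (intro cfun.subspace_sum) auto
  ultimately show "\<forall>\<^sub>F n in sequentially. (\<Sum>k<n. u k) \<in> ip_topology H ip closure_of V"
    by (auto elim!: eventually_mono simp: in_closure_of)
qed auto

text \<open>By the triangle inequality the norm of a Taylor partial sum is at most a partial sum of
  \<open>cmod (a j) * norm (w j)\<close>. These products grow subexponentially, so the factors
  \<open>c k\<close> make the series of norms converge.\<close>

lemma summable_norm_taylor_psum:
  assumes f: "1 \<le> fps_conv_radius (fps_expansion f 0)"
    and w: "1 \<le> conv_radius w" and mono: "\<And>n. on_disk (\<lambda>z. z ^ n) \<in> H"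
    and le: "\<And>n. ip_norm ip (on_disk (\<lambda>z. z ^ n)) \<le> w n"
    and c: "admissible_coeffs c"
  shows "summable (\<lambda>k. ip_norm ip (cscale (c k) (taylor_psum k f)))"
proof (rule summable_comparison_test')
  define a where "a = fps_nth (fps_expansion f 0)"
  show "summable (\<lambda>k. norm (c k) * (\<Sum>j\<le>k. cmod (a j) * norm (w j)))"
    using c f w summable_mult_subexponential[of a w]
    by (intro summable_mult_partial_sums) (auto simp: admissible_coeffs_iff a_def fps_conv_radius_def)
  fix k :: nat assume "0 \<le> k"
  have psum: "taylor_psum k f = (\<Sum>j\<le>k. cscale (a j) (on_disk (\<lambda>z. z ^ j)))"
    by (simp add: taylor_psum_eq_sum a_def)
  have in_H: "cscale (a j) (on_disk (\<lambda>z. z ^ j)) \<in> H" for j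
    using mono by (rule cfun.subspace_scale[OF subspace])
  then have psum_H: "taylor_psum k f \<in> H"
    unfolding psum by (intro cfun.subspace_sum[OF subspace])
  have "ip_norm ip (taylor_psum k f) \<le> (\<Sum>j\<le>k. ip_norm ip (cscale (a j) (on_disk (\<lambda>z. z ^ j))))"
    unfolding psum using in_H by (intro ip_norm_sum_le) auto
  also have "\<dots> \<le> (\<Sum>j\<le>k. cmod (a j) * norm (w j))"
    using mono le by (intro sum_mono) (auto simp: ip_norm_scale intro!: mult_left_mono order_trans[OF le])
  finally show "norm (ip_norm ip (cscale (c k) (taylor_psum k f)))
      \<le> norm (c k) * (\<Sum>j\<le>k. cmod (a j) * norm (w j))"
    using psum_H by (simp add: ip_norm_scale abs_mult ip_norm_nonneg mult_left_mono)
qed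

end

section \<open>Choice of the odd function and verification of both conditions\<close>

theorem corollary1p3:
  fixes \<omega> :: "nat \<Rightarrow> real"
    and H :: "(complex \<Rightarrow> complex) set"
    and ip :: "(complex \<Rightarrow> complex) \<Rightarrow> (complex \<Rightarrow> complex) \<Rightarrow> complex"
  assumes "\<And>n. \<omega> n > 0"
    and "summable (\<lambda>n. 1 / \<omega> n)"
    and "(\<lambda>n. root n (\<omega> n)) \<longlonglongrightarrow> 1"
    and "hilbert_holomorphic_space H ip"
    and "disk_polys \<subseteq> H"
    and "ip_topology H ip closure_of disk_polys = H"
    and "\<not> {g \<in> H. odd_on_disk g} \<subseteq> ip_topology H ip closure_of {p \<in> disk_polys. odd_on_disk p}"
    and "\<And>n. ip_norm ip (on_disk (\<lambda>z. z ^ n)) \<le> 1 + \<omega> n"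
  shows "\<exists>f\<in>H.
    (\<forall>c. admissible_coeffs c \<longrightarrow>
       (\<exists>s. ip_sums H ip (\<lambda>k. cscale (c k) (taylor_psum k f)) s)) \<and>
    f \<notin> ip_topology H ip closure_of (cfun.span (taylor_series_sums H ip f))"
proof -
  interpret hilbert_holomorphic_space H ip by fact
  let ?V = "{p \<in> disk_polys. odd_on_disk p}"
  let ?M = "ip_topology H ip closure_of ?V"
  obtain f where f: "f \<in> H" "odd_on_disk f" "f \<notin> ?M"
    using assms(7) by blast
  have hol: "f holomorphic_on disk"
    using f(1) subset_Hol by (auto simp: Hol_disk_def)
  have V: "cfun.subspace ?V" "?V \<subseteq> H"
    using subspace_odd_disk_polys assms(5) by auto
  have psum_V: "cscale (c k) (taylor_psum k f) \<in> ?V" for c k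
    using odd_taylor_psum[OF hol f(2)] taylor_psum_in_disk_polys
    by (intro cfun.subspace_scale[OF V(1)]) auto
  have "on_disk (\<lambda>z. z ^ n) = on_disk (poly (monom 1 n))" for n
    by (simp add: on_disk_def poly_monom fun_eq_iff)
  then have monom_H: "on_disk (\<lambda>z. z ^ n) \<in> H" for n
    using assms(5) unfolding disk_polys_def by auto
  have radius: "1 \<le> fps_conv_radius (fps_expansion f 0)"
    using conv_radius_fps_expansion[of f 0 1] hol by (simp add: one_ereal_def)
  \<comment> \<open>The root limit gives \<open>\<omega>\<close> radius 1, and the constant sequence
    1 has the same radius. A sum has at least the smaller radius, so the norm bound
    \<open>1 + \<omega> n\<close> is subexponential.\<close>
  have "(\<lambda>n. ereal (root n (norm (\<omega> n)))) \<longlonglongrightarrow> ereal 1"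
    using assms(1,3) by (simp add: less_imp_le)
  then have "limsup (\<lambda>n. ereal (root n (norm (\<omega> n)))) = ereal 1"
    by (intro lim_imp_Limsup) simp
  then have "conv_radius \<omega> = 1"
    by (simp add: conv_radius_def one_ereal_def)
  moreover have "conv_radius (\<lambda>_. 1 :: real) = 1"
    by (rule conv_radius_ratio_limit_nonzero[of _ 1]) auto
  ultimately have weight: "1 \<le> conv_radius (\<lambda>n. 1 + \<omega> n)"
    using conv_radius_add_ge[of "\<lambda>_. 1" \<omega>] by simp
  have "\<exists>s. ip_sums H ip (\<lambda>k. cscale (c k) (taylor_psum k f)) s" if "admissible_coeffs c" for c
  proof (rule ip_sums_of_summable_norm[OF complete])
    show "cscale (c k) (taylor_psum k f) \<in> H" for k
      using psum_V V(2) by blast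
    show "summable (\<lambda>k. ip_norm ip (cscale (c k) (taylor_psum k f)))"
      using radius weight monom_H assms(8) that by (rule summable_norm_taylor_psum)
  qed
  \<comment> \<open>\<open>?M\<close> is a closed subspace containing every sum of such a series,
    hence their closed linear span, while \<open>f\<close> was chosen outside it.\<close>
  moreover have "taylor_series_sums H ip f \<subseteq> ?M"
    using ip_sums_in_closure_of[OF V(1) psum_V] by (auto simp: taylor_series_sums_def)
  then have "cfun.span (taylor_series_sums H ip f) \<subseteq> ?M"
    by (rule cfun.span_minimal) (rule subspace_closure_of[OF V])
  then have "ip_topology H ip closure_of cfun.span (taylor_series_sums H ip f) \<subseteq> ?M"
    by (rule closure_of_minimal) simp
  ultimately show ?thesis
    using f by blast
qed

end
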